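(* Let $G_n$ be a graph of order $n$ with Laplacian matrix $L(G_n)$, and let $k\ge 1$ and $p\geq k$ be integers. Let $G_n\vee K_k$ be the join of $G_n$ and $K_k$, and let $K_{p}\circ_{k}(G_{n}\vee K_k)$ be the graph obtained by identifying the $k$ vertices of the $K_k$ in $G_n\vee K_k$ with $k$ vertices of $K_p$. Let $T$ be the set of these $k$ identified vertices, and write $M=(L(G_n)+kI_n)^{-1}$, whose rows and columns are indexed by $V(G_n)$. Then the resistance distances $r_{ij}$ in $K_{p}\circ_{k}(G_{n}\vee K_k)$ are: (i) for any distinct $v_i, v_j\in T$, $r_{ij}= \frac{2}{p+n}$; (ii) for $v_i\in T$, $v_j\in V(K_{p})\setminus T$, $r_{ij}= \frac{k(2p+n)+n}{kp(p+n)}$; (iii) for $v_i\in T$, $v_j\in V(G_{n})$, $r_{ij}= \frac{k-1}{k(p+n)}+M_{jj}$; (iv) for any distinct $v_i, v_j\in V(K_{p})\setminus T$, $r_{ij}= \frac{2}{p}$; (v) for $v_i\in V(K_{p})\setminus T$, $v_j\in V(G_{n})$, $r_{ij}= \frac{k+1}{kp}+M_{jj}$; (vi) for any distinct $v_i, v_j\in V(G_{n})$, $r_{ij}= M_{ii}+M_{jj}-2M_{ij}$.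
   Context: The join $G\vee H$ of disjoint graphs $G,H$ is obtained from $G\cup H$ by adding all edges between $V(G)$ and $V(H)$. The Laplacian of a graph is $L=D-A$ ($D$ the diagonal degree matrix, $A$ the adjacency matrix). The resistance distance $r_{ij}$ between vertices of a connected graph is the effective resistance between them when every edge is a resistor of $1\Omega$; equivalently $r_{ij}=l^{\#}_{ii}+l^{\#}_{jj}-2l^{\#}_{ij}$ with $L^{\#}$ the group inverse of the Laplacian. *)

theory Defs
  imports "HOL-Analysis.Analysis"
begin

text \<open>A simple graph is given by its adjacency relation; its vertex set is the whole (finite)
  type, so that its order is the cardinality of that type and matrices indexed by the vertices
  have type \<open>real^'v^'v\<close>.\<close>

definition simple_graph :: "('v \<Rightarrow> 'v \<Rightarrow> bool) \<Rightarrow> bool" where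
  "simple_graph G \<longleftrightarrow> symp G \<and> irreflp G"

definition connected_graph :: "('v \<Rightarrow> 'v \<Rightarrow> bool) \<Rightarrow> bool" where
  "connected_graph G \<longleftrightarrow> (\<forall>u v. G\<^sup>*\<^sup>* u v)"

definition complete_graph :: "'v \<Rightarrow> 'v \<Rightarrow> bool" where
  "complete_graph u v \<longleftrightarrow> u \<noteq> v"

fun graph_join :: "('a \<Rightarrow> 'a \<Rightarrow> bool) \<Rightarrow> ('b \<Rightarrow> 'b \<Rightarrow> bool) \<Rightarrow> 'a + 'b \<Rightarrow> 'a + 'b \<Rightarrow> bool" where
  "graph_join G H (Inl a) (Inl a') = G a a'"
| "graph_join G H (Inr b) (Inr b') = H b b'"
| "graph_join G H (Inl a) (Inr b) = True"
| "graph_join G H (Inr b) (Inl a) = True"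

text \<open>\<open>identify_vertices f G H\<close> is obtained from the disjoint union of \<open>H\<close> and \<open>G\<close> by identifying
  each vertex \<open>Inr x\<close> of \<open>G\<close> with the vertex \<open>f x\<close> of \<open>H\<close>; it is meant for injective \<open>f\<close>.
  The vertices of the result are the vertices \<open>Inl a\<close> of \<open>G\<close> that are not identified, together with
  a copy \<open>Inr y\<close> of every vertex \<open>y\<close> of \<open>H\<close>.\<close>

definition identify_vertices ::
  "('b \<Rightarrow> 'c) \<Rightarrow> ('a + 'b \<Rightarrow> 'a + 'b \<Rightarrow> bool) \<Rightarrow> ('c \<Rightarrow> 'c \<Rightarrow> bool) \<Rightarrow> 'a + 'c \<Rightarrow> 'a + 'c \<Rightarrow> bool" where
  "identify_vertices f G H u v \<longleftrightarrow>
     (\<exists>x y. G x y \<and> u = map_sum id f x \<and> v = map_sum id f y) \<or>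
     (\<exists>x y. H x y \<and> u = Inr x \<and> v = Inr y)"

definition adjacency_matrix :: "('v::finite \<Rightarrow> 'v \<Rightarrow> bool) \<Rightarrow> real^'v^'v" where
  "adjacency_matrix G = (\<chi> i j. if G i j then 1 else 0)"

definition degree_matrix :: "('v::finite \<Rightarrow> 'v \<Rightarrow> bool) \<Rightarrow> real^'v^'v" where
  "degree_matrix G = (\<chi> i j. if i = j then real (card {w. G i w}) else 0)"

definition laplacian :: "('v::finite \<Rightarrow> 'v \<Rightarrow> bool) \<Rightarrow> real^'v^'v" where
  "laplacian G = degree_matrix G - adjacency_matrix G"

definition is_group_inverse :: "real^'v^'v \<Rightarrow> real^'v^'v \<Rightarrow> bool" where
  "is_group_inverse A X \<longleftrightarrow> A ** X ** A = A \<and> X ** A ** X = X \<and> A ** X = X ** A"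

definition group_inverse :: "real^'v^'v \<Rightarrow> real^'v^'v" where
  "group_inverse A = (THE X. is_group_inverse A X)"

definition resistance_distance :: "('v::finite \<Rightarrow> 'v \<Rightarrow> bool) \<Rightarrow> 'v \<Rightarrow> 'v \<Rightarrow> real" where
  "resistance_distance G i j =
     group_inverse (laplacian G) $ i $ i + group_inverse (laplacian G) $ j $ j
       - 2 * group_inverse (laplacian G) $ i $ j"

lemma is_group_inverse_unique:
  assumes "is_group_inverse A X" "is_group_inverse A Y"
  shows "X = Y"
proof -
  have X: "A ** X ** A = A" "X ** A ** X = X" "A ** X = X ** A"
    and Y: "A ** Y ** A = A" "Y ** A ** Y = Y" "A ** Y = Y ** A"
    using assms by (auto simp: is_group_inverse_def)
  have 1: "A ** X = (A ** Y) ** (A ** X)"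
    using Y(1) by (metis matrix_mul_assoc)
  have 2: "A ** Y = (A ** Y) ** (A ** X)"
    using X(1,3) Y(3) by (metis matrix_mul_assoc)
  have E: "A ** X = A ** Y" using 1 2 by simp
  have "X = X ** (A ** X)" using X(2) by (simp add: matrix_mul_assoc)
  also have "\<dots> = (X ** A) ** Y" by (simp add: E matrix_mul_assoc)
  also have "\<dots> = Y" using E X(3) Y(2,3) by simp
  finally show ?thesis .
qed

lemma group_inverse_eqI: "is_group_inverse A X \<Longrightarrow> group_inverse A = X"
  unfolding group_inverse_def by (rule the_equality) (auto dest: is_group_inverse_unique)

lemma laplacian_mult_vec:
  "(laplacian G *v x) $ i = (\<Sum>j | G i j. x $ i - x $ j)" for x :: "real^'v::finite"
proof -
  have "(laplacian G *v x) $ i =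
      (\<Sum>j\<in>UNIV. (if i = j then real (card {w. G i w}) * x $ i else 0) - (if G i j then x $ j else 0))"
    by (auto simp: laplacian_def degree_matrix_def adjacency_matrix_def matrix_vector_mult_def
        left_diff_distrib intro!: sum.cong)
  also have "\<dots> = real (card {w. G i w}) * x $ i - (\<Sum>j | G i j. x $ j)"
    by (simp add: sum_subtractf sum.If_cases)
  also have "\<dots> = (\<Sum>j | G i j. x $ i - x $ j)"
    by (simp add: sum_subtractf)
  finally show ?thesis .
qed

lemma laplacian_quadratic_form:
  assumes "simple_graph G"
  shows "2 * (x \<bullet> (laplacian G *v x)) = (\<Sum>i\<in>UNIV. \<Sum>j | G i j. (x $ i - x $ j)\<^sup>2)"
proof -
  have sym: "G i j = G j i" for i j
    using assms by (auto simp: simple_graph_def dest: sympD)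
  let ?g = "\<lambda>i j. if G i j then x $ i * (x $ i - x $ j) else 0"
  have e: "x \<bullet> (laplacian G *v x) = (\<Sum>i\<in>UNIV. \<Sum>j\<in>UNIV. ?g i j)"
    by (simp add: inner_vec_def laplacian_mult_vec sum_distrib_left sum.If_cases)
  have e': "x \<bullet> (laplacian G *v x) = (\<Sum>i\<in>UNIV. \<Sum>j\<in>UNIV. ?g j i)"
    unfolding e by (rule sum.swap)
  have "2 * (x \<bullet> (laplacian G *v x)) = (\<Sum>i\<in>UNIV. \<Sum>j\<in>UNIV. ?g i j + ?g j i)"
    using e e' by (simp add: sum.distrib)
  also have "\<dots> = (\<Sum>i\<in>UNIV. \<Sum>j\<in>UNIV. if G i j then (x $ i - x $ j)\<^sup>2 else 0)"
    by (intro sum.cong refl) (auto simp: sym power2_eq_square algebra_simps)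
  also have "\<dots> = (\<Sum>i\<in>UNIV. \<Sum>j | G i j. (x $ i - x $ j)\<^sup>2)"
    by (simp add: sum.If_cases)
  finally show ?thesis .
qed

lemma laplacian_kernel:
  assumes "simple_graph G" "connected_graph G" "laplacian G *v x = 0"
  shows "x $ u = x $ v"
proof -
  have "(\<Sum>i\<in>UNIV. \<Sum>j | G i j. (x $ i - x $ j)\<^sup>2) = 0"
    using laplacian_quadratic_form[OF assms(1), of x] assms(3) by simp
  hence "\<forall>i. (\<Sum>j | G i j. (x $ i - x $ j)\<^sup>2) = 0"
    by (subst (asm) sum_nonneg_eq_0_iff) (auto intro: sum_nonneg)
  hence "\<forall>i j. G i j \<longrightarrow> (x $ i - x $ j)\<^sup>2 = 0"
    by (subst (asm) sum_nonneg_eq_0_iff) auto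
  hence *: "\<And>i j. G i j \<Longrightarrow> x $ i = x $ j" by simp
  have "G\<^sup>*\<^sup>* u v" using assms(2) by (simp add: connected_graph_def)
  thus ?thesis by induction (auto dest: *)
qed

lemma transpose_laplacian: "simple_graph G \<Longrightarrow> transpose (laplacian G) = laplacian G"
  by (auto simp: vec_eq_iff transpose_def laplacian_def degree_matrix_def adjacency_matrix_def
      simple_graph_def dest: sympD)

lemma laplacian_group_inverse_exists:
  fixes G :: "'v::finite \<Rightarrow> 'v \<Rightarrow> bool"
  assumes "simple_graph G" "connected_graph G"
  shows "\<exists>X. is_group_inverse (laplacian G) X \<and> transpose X = X \<and>
           laplacian G ** X = mat 1 - (\<chi> i j. 1 / real CARD('v))"
proof -
  define L where "L = laplacian G"
  define c where "c = 1 / real CARD('v)"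
  define J :: "real^'v^'v" where "J = (\<chi> i j. c)"
  have add_r: "(A + B) ** C = A ** C + B ** C"
    and sub_r: "(A - B) ** C = A ** C - B ** C"
    and sub_l: "C ** (A - B) = C ** A - C ** B" for A B C :: "real^'v^'v"
    by (simp_all add: matrix_matrix_mult_def vec_eq_iff algebra_simps sum.distrib sum_subtractf)
  have Jv: "(J *v x) $ i = c * (\<Sum>j\<in>UNIV. x $ j)" for x i
    by (simp add: J_def matrix_vector_mult_def sum_distrib_left)
  have tL: "transpose L = L" unfolding L_def by (rule transpose_laplacian[OF assms(1)])
  have tJ: "transpose J = J" by (simp add: J_def transpose_def vec_eq_iff)
  have JJ: "J ** J = J" by (simp add: J_def c_def matrix_matrix_mult_def vec_eq_iff)
  have LJ: "L ** J = 0"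
    by (simp add: matrix_eq L_def vec_eq_iff laplacian_mult_vec Jv
        flip: matrix_vector_mul_assoc)
  have JL: "J ** L = 0"
  proof -
    have "J ** L = transpose (L ** J)" by (simp add: matrix_transpose_mul tL tJ)
    thus ?thesis by (simp add: LJ transpose_def vec_eq_iff)
  qed
  have "x = 0" if x: "(L + J) *v x = 0" for x
  proof -
    have a: "L *v x + J *v x = 0"
      using x by (simp add: matrix_vector_mult_add_rdistrib)
    have "J *v (L *v x) + J *v (J *v x) = 0"
      using a by (metis matrix_vector_mult_0_right matrix_vector_right_distrib)
    hence Jx: "J *v x = 0"
      by (simp add: matrix_vector_mul_assoc JL JJ)
    hence "L *v x = 0" using a by simp
    hence const: "x $ u = x $ v" for u v
      using laplacian_kernel[OF assms] unfolding L_def by blast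
    have "x $ u = 0" for u
    proof -
      have "c * (\<Sum>j\<in>UNIV. x $ j) = 0" using Jv[of x u] Jx by simp
      moreover have "(\<Sum>j\<in>UNIV. x $ j) = (\<Sum>j\<in>(UNIV::'v set). x $ u)"
        by (rule sum.cong) (auto intro: const)
      ultimately show ?thesis by (simp add: c_def)
    qed
    thus ?thesis by (simp add: vec_eq_iff)
  qed
  then obtain B where B: "B ** (L + J) = mat 1"
    using matrix_left_invertible_ker by blast
  hence B': "(L + J) ** B = mat 1" using matrix_left_right_inverse by blast
  have tB: "transpose B = B"
  proof -
    have "transpose B ** transpose (L + J) = mat 1"
      using B' by (metis matrix_transpose_mul transpose_mat)
    moreover have "transpose (L + J) = L + J"
      using tL tJ by (simp add: transpose_def vec_eq_iff)
    ultimately have "transpose B ** (L + J) = mat 1" by simp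
    thus ?thesis using B' by (metis matrix_mul_assoc matrix_mul_lid matrix_mul_rid)
  qed
  have BJ: "B ** J = J"
  proof -
    have "(L + J) ** J = J" by (simp add: add_r LJ JJ)
    thus ?thesis using B by (metis matrix_mul_assoc matrix_mul_lid)
  qed
  have JB: "J ** B = J"
    using arg_cong[OF BJ, of transpose] tB tJ by (simp add: matrix_transpose_mul)
  define X where "X = B - J"
  have LB: "L ** B = mat 1 - J"
    using B' JB by (simp add: add_r algebra_simps)
  have BL: "B ** L = mat 1 - J"
    using B BJ by (simp add: matrix_add_ldistrib algebra_simps)
  have LX: "L ** X = mat 1 - J"
    using LB LJ by (simp add: X_def sub_l)
  have XL: "X ** L = mat 1 - J"
    using BL JL by (simp add: X_def sub_r)
  have "is_group_inverse L X"
    unfolding is_group_inverse_def LX XL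
    by (simp add: sub_r JL X_def sub_l JB JJ)
  moreover have "transpose X = X"
    using tB tJ by (simp add: X_def transpose_def vec_eq_iff)
  ultimately show ?thesis
    using LX unfolding L_def J_def c_def by blast
qed

text \<open>The formula defining \<^const>\<open>resistance_distance\<close> is the effective resistance of the
  network whose edges are unit resistors: if \<open>\<phi>\<close> is a potential for a unit current entering at
  \<open>u\<close> and leaving at \<open>v\<close> (Kirchhoff's current law and Ohm's law), it is the voltage
  \<open>\<phi> u - \<phi> v\<close>; such a potential exists.\<close>

lemma resistance_distance_iff_effective_resistance:
  fixes G :: "'v::finite \<Rightarrow> 'v \<Rightarrow> bool"
  assumes "simple_graph G" "connected_graph G"
  shows "resistance_distance G u v = r \<longleftrightarrow>
    (\<exists>\<phi>. (\<forall>w. (\<Sum>x | G w x. \<phi> w - \<phi> x) = of_bool (w = u) - of_bool (w = v)) \<and> r = \<phi> u - \<phi> v)"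
proof -
  obtain X where X: "is_group_inverse (laplacian G) X" "transpose X = X"
    "laplacian G ** X = mat 1 - (\<chi> i j. 1 / real CARD('v))"
    using laplacian_group_inverse_exists[OF assms] by blast
  have gi: "group_inverse (laplacian G) = X" by (rule group_inverse_eqI[OF X(1)])
  have symX: "X $ i $ j = X $ j $ i" for i j
    using X(2) by (metis transpose_def vec_lambda_beta)
  define e where "e = (axis u 1 - axis v 1 :: real^'v)"
  have e: "e $ w = of_bool (w = u) - of_bool (w = v)" for w
    by (auto simp: e_def axis_def)
  define p where "p = X *v e"
  have p: "p $ w = X $ w $ u - X $ w $ v" for w
    by (simp add: p_def e_def matrix_vector_mult_diff_distrib matrix_vector_mult_basis column_def)
  have Lp: "laplacian G *v p = e"
  proof -
    have "laplacian G *v p = e - (\<chi> i j. 1 / real CARD('v)) *v e"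
      by (simp add: p_def matrix_vector_mul_assoc X(3) matrix_vector_mult_diff_rdistrib)
    also have "(\<chi> i j. 1 / real CARD('v)) *v e = 0"
      by (simp add: e_def matrix_vector_mult_diff_distrib matrix_vector_mult_basis column_def)
    finally show ?thesis by simp
  qed
  have rp: "resistance_distance G u v = p $ u - p $ v"
    by (simp add: resistance_distance_def gi p symX[of v u])
  show ?thesis
  proof
    assume "resistance_distance G u v = r"
    thus "\<exists>\<phi>. (\<forall>w. (\<Sum>x | G w x. \<phi> w - \<phi> x) = of_bool (w = u) - of_bool (w = v)) \<and> r = \<phi> u - \<phi> v"
      using Lp rp by (intro exI[of _ "\<lambda>w. p $ w"]) (metis laplacian_mult_vec e)
  next
    assume "\<exists>\<phi>. (\<forall>w. (\<Sum>x | G w x. \<phi> w - \<phi> x) = of_bool (w = u) - of_bool (w = v)) \<and> r = \<phi> u - \<phi> v"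
    then obtain \<phi> where \<phi>: "\<And>w. (\<Sum>x | G w x. \<phi> w - \<phi> x) = of_bool (w = u) - of_bool (w = v)"
      "r = \<phi> u - \<phi> v" by blast
    have "laplacian G *v (\<chi> w. \<phi> w) = e"
      by (simp add: vec_eq_iff laplacian_mult_vec e \<phi>(1))
    hence "laplacian G *v ((\<chi> w. \<phi> w) - p) = 0"
      by (simp add: matrix_vector_mult_diff_distrib Lp)
    from laplacian_kernel[OF assms this, of u v] show "resistance_distance G u v = r"
      by (simp add: rp \<phi>(2))
  qed
qed

end

theory Submission
  imports Defs
begin

text \<open>The resistance distance is the voltage between the two vertices under any potential driven
  by a unit current, so it suffices to exhibit potentials. Normalise them so that their values on
  \<open>T\<close> sum to \<open>0\<close>. On \<open>G\<close> a potential then satisfies \<open>(L(G) + k I) f = b\<close> for the injected current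
  \<open>b\<close>, whence \<open>f = M b\<close>. The column sums of \<open>L(G) + k I\<close> being \<open>k\<close>, the sum of \<open>f\<close> is the total of
  \<open>b\<close> divided by \<open>k\<close>, and on the vertices of the big clique one is left with a diagonal system.\<close>

abbreviation (input) clique_join ::
  "('k \<Rightarrow> 'p) \<Rightarrow> ('a \<Rightarrow> 'a \<Rightarrow> bool) \<Rightarrow> 'a + 'p \<Rightarrow> 'a + 'p \<Rightarrow> bool" where
  "clique_join \<iota> G \<equiv> identify_vertices \<iota> (graph_join G complete_graph) complete_graph"

text \<open>\<open>Inl\<close> carries the vertices of \<open>G\<close> and \<open>Inr\<close> those
  of the big clique, with \<open>range \<iota>\<close> as the identified ones. By injectivity an
  edge of the small clique becomes an edge between distinct vertices of the big one, where it is
  already present: identification creates neither loops nor new edges there.\<close>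

lemma clique_join_iff [simp]:
  assumes "inj \<iota>"
  shows "clique_join \<iota> G (Inl a) (Inl b) \<longleftrightarrow> G a b"
    and "clique_join \<iota> G (Inl a) (Inr y) \<longleftrightarrow> y \<in> range \<iota>"
    and "clique_join \<iota> G (Inr y) (Inl a) \<longleftrightarrow> y \<in> range \<iota>"
    and "clique_join \<iota> G (Inr y) (Inr z) \<longleftrightarrow> y \<noteq> z"
proof -
  \<comment> \<open>Splits the existentials in \<open>identify_vertices\<close> by summand, so that
    \<open>map_sum\<close> and \<open>graph_join\<close> can be evaluated.\<close>
  have split: "(\<exists>u. P u) \<longleftrightarrow> (\<exists>a. P (Inl a)) \<or> (\<exists>b. P (Inr b))" for P :: "'x + 'y \<Rightarrow> bool"
    by (metis sum.exhaust)
  show "clique_join \<iota> G (Inl a) (Inl b) \<longleftrightarrow> G a b"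
    "clique_join \<iota> G (Inl a) (Inr y) \<longleftrightarrow> y \<in> range \<iota>"
    "clique_join \<iota> G (Inr y) (Inl a) \<longleftrightarrow> y \<in> range \<iota>"
    "clique_join \<iota> G (Inr y) (Inr z) \<longleftrightarrow> y \<noteq> z"
    using assms by (auto simp: identify_vertices_def complete_graph_def split dest: injD)
qed

lemma simple_graph_clique_join:
  assumes "simple_graph G" "inj \<iota>"
  shows "simple_graph (clique_join \<iota> G)"
  unfolding simple_graph_def
proof (intro conjI sympI irreflpI)
  fix u v assume "clique_join \<iota> G u v"
  then show "clique_join \<iota> G v u"
    using assms by (cases u; cases v) (auto simp: simple_graph_def dest: sympD)
next
  fix u show "\<not> clique_join \<iota> G u u"
    using assms by (cases u) (auto simp: simple_graph_def irreflp_def)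
qed

lemma connected_graph_clique_join:
  assumes "inj (\<iota> :: 'k \<Rightarrow> 'p)"
  shows "connected_graph (clique_join \<iota> G)"
proof -
  let ?H = "clique_join \<iota> G"
  \<comment> \<open>Any identified vertex serves as a hub: it is adjacent to all of \<open>G\<close>
    and to the rest of the big clique.\<close>
  define h :: "'a + 'p" where "h = Inr (\<iota> undefined)"
  have "?H\<^sup>*\<^sup>* u h \<and> ?H\<^sup>*\<^sup>* h u" for u
  proof (cases "u = h")
    case False
    then have "?H u h \<and> ?H h u"
      using assms by (cases u) (auto simp: h_def)
    then show ?thesis by blast
  qed simp
  then show ?thesis
    unfolding connected_graph_def by (meson rtranclp_trans)
qed

text \<open>The assumptions are Kirchhoff's current law, vertex by vertex. At \<open>Inl a\<close>
  the \<open>k\<close> edges into the identified vertices contribute \<open>k * f $ a\<close>, since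
  \<open>g\<close> sums to 0 there; this produces the shifted Laplacian. At \<open>Inr y\<close> the
  clique contributes the first two terms, and an identified \<open>y\<close> also sees every vertex
  of \<open>G\<close>.\<close>

lemma resistance_distance_clique_join:
  fixes \<iota> :: "'k::finite \<Rightarrow> 'p::finite" and G :: "'a::finite \<Rightarrow> 'a \<Rightarrow> bool"
    and f :: "real^'a" and g :: "'p \<Rightarrow> real"
  assumes "simple_graph G" "inj \<iota>"
    and f: "\<And>a. ((laplacian G + real CARD('k) *\<^sub>R mat 1) *v f) $ a =
              of_bool (Inl a = u) - of_bool (Inl a = v)"
    and T: "(\<Sum>y\<in>range \<iota>. g y) = 0"
    and g: "\<And>y. real CARD('p) * g y - sum g UNIV +
                of_bool (y \<in> range \<iota>) * (real CARD('a) * g y - (\<Sum>a\<in>UNIV. f $ a)) =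
              of_bool (Inr y = u) - of_bool (Inr y = v)"
  shows "resistance_distance (clique_join \<iota> G) u v =
           case_sum (($) f) g u - case_sum (($) f) g v"
proof (subst resistance_distance_iff_effective_resistance, goal_cases)
  case 3
  let ?H = "clique_join \<iota> G" and ?\<phi> = "case_sum (($) f) g"
  have "(\<Sum>x | ?H w x. ?\<phi> w - ?\<phi> x) = of_bool (w = u) - of_bool (w = v)" for w
  proof (cases w)
    case (Inl a)
    have "{x. ?H w x} = Inl ` {b. G a b} \<union> Inr ` range \<iota>"
    proof (rule set_eqI)
      fix x show "x \<in> {x. ?H w x} \<longleftrightarrow> x \<in> Inl ` {b. G a b} \<union> Inr ` range \<iota>"
        using assms(2) Inl by (cases x) auto
    qed
    then have "(\<Sum>x | ?H w x. ?\<phi> w - ?\<phi> x) =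
        (\<Sum>x\<in>Inl ` {b. G a b}. ?\<phi> w - ?\<phi> x) + (\<Sum>x\<in>Inr ` range \<iota>. ?\<phi> w - ?\<phi> x)"
      by (simp only:) (rule sum.union_disjoint, auto)
    also have "\<dots> = (\<Sum>b | G a b. f $ a - f $ b) + (\<Sum>y\<in>range \<iota>. f $ a - g y)"
      by (simp add: sum.reindex Inl o_def)
    also have "\<dots> = (laplacian G *v f) $ a + real CARD('k) * f $ a"
      using T by (simp add: laplacian_mult_vec sum_subtractf card_image[OF assms(2)])
    also have "\<dots> = ((laplacian G + real CARD('k) *\<^sub>R mat 1) *v f) $ a"
      by (simp add: matrix_vector_mult_add_rdistrib scaleR_matrix_vector_assoc[symmetric])
    finally show ?thesis using f Inl by simp
  next
    case (Inr y)
    have N: "{x. ?H w x} = (if y \<in> range \<iota> then range Inl else {}) \<union> Inr ` (UNIV - {y})"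
    proof (rule set_eqI)
      fix x
      show "x \<in> {x. ?H w x} \<longleftrightarrow>
          x \<in> (if y \<in> range \<iota> then range Inl else {}) \<union> Inr ` (UNIV - {y})"
        using assms(2) Inr by (cases x) auto
    qed
    have "(\<Sum>x | ?H w x. ?\<phi> w - ?\<phi> x) =
        (\<Sum>x\<in>(if y \<in> range \<iota> then range Inl else {}). ?\<phi> w - ?\<phi> x) +
        (\<Sum>x\<in>Inr ` (UNIV - {y}). ?\<phi> w - ?\<phi> x)"
      unfolding N by (rule sum.union_disjoint) auto
    also have "(\<Sum>x\<in>(if y \<in> range \<iota> then range Inl else {}). ?\<phi> w - ?\<phi> x) =
        of_bool (y \<in> range \<iota>) * (\<Sum>a\<in>UNIV. g y - f $ a)"
      by (simp add: sum.reindex Inr o_def)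
    also have "(\<Sum>x\<in>Inr ` (UNIV - {y}). ?\<phi> w - ?\<phi> x) = (\<Sum>z\<in>UNIV - {y}. g y - g z)"
      by (simp add: sum.reindex Inr o_def)
    \<comment> \<open>The added term \<open>z = y\<close> is zero, so \<open>y\<close> may be
      counted among its own neighbours.\<close>
    also have "\<dots> = (\<Sum>z\<in>UNIV. g y - g z)"
      by (simp add: sum.remove[of UNIV y])
    finally show ?thesis
      using g[of y] Inr by (simp add: sum_subtractf)
  qed
  then show ?case by blast
qed (use assms simple_graph_clique_join connected_graph_clique_join in auto)

text \<open>The Laplacian is positive semidefinite, so adding a positive multiple of the identity
  makes it positive definite, hence invertible; symmetry passes to the inverse. Constant vectors lie
  in the kernel of the Laplacian, so they are eigenvectors of \<open>A\<close> for \<open>c\<close>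
  and of the inverse for \<open>1 / c\<close>.\<close>

lemma
  fixes G :: "'a::finite \<Rightarrow> 'a \<Rightarrow> bool" and c :: real
  assumes "simple_graph G" "c > 0"
  defines "A \<equiv> laplacian G + c *\<^sub>R mat 1"
  shows shifted_laplacian_mult_inv: "A ** matrix_inv A = mat 1"
    and shifted_laplacian_inv_symmetric: "matrix_inv A $ i $ j = matrix_inv A $ j $ i"
    and shifted_laplacian_inv_sum: "(\<Sum>i\<in>UNIV. matrix_inv A $ i $ j) = 1 / c"
proof -
  have Av: "A *v x = laplacian G *v x + c *\<^sub>R x" for x
    by (simp add: A_def matrix_vector_mult_add_rdistrib scaleR_matrix_vector_assoc[symmetric])
  have "x = 0" if "A *v x = 0" for x
  proof -
    have "2 * (x \<bullet> (laplacian G *v x)) \<ge> 0"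
      unfolding laplacian_quadratic_form[OF assms(1)] by (intro sum_nonneg) auto
    moreover have "x \<bullet> (laplacian G *v x) + c * (x \<bullet> x) = 0"
      using that by (metis Av inner_add_right inner_scaleR_right inner_zero_right)
    moreover have "c * (x \<bullet> x) > 0" if "x \<noteq> 0"
      using that assms(2) by simp
    ultimately show ?thesis by force
  qed
  then obtain B where "B ** A = mat 1"
    using matrix_left_invertible_ker by blast
  \<comment> \<open>\<open>matrix_inv\<close> is a choice of a two-sided inverse, so its equations
    follow once one exists.\<close>
  then have "\<exists>B. A ** B = mat 1 \<and> B ** A = mat 1"
    using matrix_left_right_inverse by blast
  then have inv: "A ** matrix_inv A = mat 1" "matrix_inv A ** A = mat 1"
    using someI_ex[of "\<lambda>B. A ** B = mat 1 \<and> B ** A = mat 1"] by (simp_all add: matrix_inv_def)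
  then show "A ** matrix_inv A = mat 1" by simp
  have tA: "transpose A = A"
    using transpose_laplacian[OF assms(1)]
    by (simp add: A_def transpose_def vec_eq_iff mat_def)
  \<comment> \<open>The transposed inverse is a left inverse of the symmetric \<open>A\<close>, and
    a left inverse equals any right inverse.\<close>
  have "transpose (matrix_inv A) ** A = mat 1"
    using inv(1) tA by (metis matrix_transpose_mul transpose_mat)
  then have t: "transpose (matrix_inv A) = matrix_inv A"
    using inv(1) by (metis matrix_mul_assoc matrix_mul_lid matrix_mul_rid)
  have sym: "matrix_inv A $ a $ b = matrix_inv A $ b $ a" for a b
    using arg_cong[OF t, of "\<lambda>X. X $ b $ a"] by (simp add: transpose_def)
  show "matrix_inv A $ i $ j = matrix_inv A $ j $ i" by (rule sym)
  have "A *v 1 = c *\<^sub>R 1"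
    by (simp add: Av vec_eq_iff laplacian_mult_vec)
  then have "c *\<^sub>R (matrix_inv A *v 1) = 1"
    by (metis inv(2) matrix_vector_mul_assoc matrix_vector_mul_lid matrix_vector_mult_scaleR)
  \<comment> \<open>These are row sums; symmetry turns them into column sums.\<close>
  then have "c * (\<Sum>i\<in>UNIV. matrix_inv A $ j $ i) = 1"
    by (simp add: vec_eq_iff matrix_vector_mult_def)
  then show "(\<Sum>i\<in>UNIV. matrix_inv A $ i $ j) = 1 / c"
    using assms(2) sym[of _ j] by (simp add: field_simps)
qed

theorem theorem3p2:
  fixes G :: "'a::finite \<Rightarrow> 'a \<Rightarrow> bool"
    and \<iota> :: "'k::finite \<Rightarrow> 'p::finite"
    and n k p :: nat
  defines "r \<equiv> resistance_distance
                 (identify_vertices \<iota>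
                    (graph_join G (complete_graph :: 'k \<Rightarrow> 'k \<Rightarrow> bool))
                    (complete_graph :: 'p \<Rightarrow> 'p \<Rightarrow> bool))"
    and "VK \<equiv> range (Inr :: 'p \<Rightarrow> 'a + 'p)"
    and "T \<equiv> (Inr ` range \<iota> :: ('a + 'p) set)"
    and "M \<equiv> matrix_inv (laplacian G + real k *\<^sub>R mat 1)"
  assumes "simple_graph G" and "n = CARD('a)"
    and "k = CARD('k)" and "p = CARD('p)"
    and "1 \<le> k" and "k \<le> p"
    and "inj \<iota>"
  shows
    "(\<forall>u\<in>T. \<forall>v\<in>T. u \<noteq> v \<longrightarrow> r u v = 2 / (real p + real n)) \<and>
     (\<forall>u\<in>T. \<forall>v\<in>VK - T. r u v =
        (real k * (2 * real p + real n) + real n) / (real k * real p * (real p + real n))) \<and>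
     (\<forall>u\<in>T. \<forall>j. r u (Inl j) = (real k - 1) / (real k * (real p + real n)) + M $ j $ j) \<and>
     (\<forall>u\<in>VK - T. \<forall>v\<in>VK - T. u \<noteq> v \<longrightarrow> r u v = 2 / real p) \<and>
     (\<forall>u\<in>VK - T. \<forall>j. r u (Inl j) = (real k + 1) / (real k * real p) + M $ j $ j) \<and>
     (\<forall>i j. i \<noteq> j \<longrightarrow> r (Inl i) (Inl j) = M $ i $ i + M $ j $ j - 2 * M $ i $ j)"
proof -
  define A where "A = laplacian G + real k *\<^sub>R mat 1"
  define R where "R = range \<iota>"
  have k: "real k > 0" and p: "real p > 0" and pn: "real p + real n > 0"
    using assms(9,10) by linarith+
  have cardR: "card R = k" "card (- R) = p - k"
    using assms(7,8,11) by (simp_all add: R_def card_image Compl_eq_Diff_UNIV card_Diff_subset)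
  have AM: "A *v (M *v b) = b" for b
    using shifted_laplacian_mult_inv[OF assms(5) k]
    by (simp add: A_def M_def matrix_vector_mul_assoc)
  have Mcol: "(M *v axis j 1) $ i = M $ i $ j" for i j
    by (simp add: matrix_vector_mult_basis column_def)
  have Mneg: "M *v - b = - (M *v b)" for b
    by (rule linear_neg[OF matrix_vector_mul_linear])
  have Msym: "M $ i $ j = M $ j $ i" for i j
    unfolding M_def by (rule shifted_laplacian_inv_symmetric[OF assms(5) k])
  have Msum: "(\<Sum>i\<in>UNIV. M $ i $ j) = 1 / real k" for j
    unfolding M_def by (rule shifted_laplacian_inv_sum[OF assms(5) k])
  have UNIV_sum: "sum g UNIV = sum g R + sum g (- R)" for g :: "'p \<Rightarrow> real"
    using sum.subset_diff[of R UNIV g] by (simp add: Compl_eq_Diff_UNIV)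
  \<comment> \<open>The numerators of \<open>g\<close> on \<open>R\<close> in cases (ii) and (iii).
    There \<open>sum g UNIV\<close> plus the sum of \<open>f\<close> is \<open>- 1 / k\<close>,
    exactly what makes \<open>g\<close> sum to 0 over \<open>R\<close>.\<close>
  have sum_R: "(\<Sum>y\<in>R. of_bool (y = s) - 1 / real k) = 0" if "s \<in> R" for s
    using that k by (simp add: sum_subtractf cardR)
  \<comment> \<open>The numerators of \<open>g\<close> outside \<open>R\<close>, up to sign, in
    cases (ii) and (v). Division by \<open>p\<close> leaves \<open>1 / k\<close>, consistent with
    the value of \<open>sum g UNIV\<close> used to form them.\<close>
  have sum_Compl: "(\<Sum>y\<in>- R. of_bool (y = t) + 1 / real k) = real p / real k" if "t \<notin> R" for t
  proof -
    have "(\<Sum>y\<in>- R. of_bool (y = t) + 1 / real k) = 1 + (real p - real k) / real k"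
      using that assms(10) by (simp add: sum.distrib cardR of_nat_diff)
    also have "\<dots> = real p / real k"
      using k by (simp add: diff_divide_distrib)
    finally show ?thesis .
  qed
  \<comment> \<open>Given the sums of \<open>f\<close> and \<open>g\<close>, each equation
    determines one value of \<open>g\<close>. Let \<open>S\<close> be \<open>sum g UNIV\<close> and
    \<open>b\<close> the net current entering outside \<open>R\<close>. As \<open>g\<close> sums to
    0 over \<open>R\<close>, adding the equations outside \<open>R\<close> gives
    \<open>p * S = (p - k) * S + b\<close>, so \<open>S = b / k\<close>. The witnesses below are
    read off from this.\<close>
  have pot: "r u v = case_sum (($) f) g u - case_sum (($) f) g v"
    if "\<And>a. (A *v f) $ a = of_bool (Inl a = u) - of_bool (Inl a = v)"
      "sum g R = 0"
      "\<And>y. y \<in> R \<Longrightarrow> (real p + real n) * g y =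
          sum g UNIV + (\<Sum>a\<in>UNIV. f $ a) + of_bool (Inr y = u) - of_bool (Inr y = v)"
      "\<And>y. y \<notin> R \<Longrightarrow> real p * g y =
          sum g UNIV + of_bool (Inr y = u) - of_bool (Inr y = v)"
    for f g u v
    unfolding r_def
  proof (rule resistance_distance_clique_join)
    show "real CARD('p) * g y - sum g UNIV +
        of_bool (y \<in> range \<iota>) * (real CARD('a) * g y - (\<Sum>a\<in>UNIV. f $ a)) =
      of_bool (Inr y = u) - of_bool (Inr y = v)" for y
      using that(3,4)[of y] assms(6,8) by (cases "y \<in> R") (simp_all add: R_def algebra_simps)
  qed (use that(1,2) assms in \<open>simp_all add: A_def R_def\<close>)
  have i: "r (Inr s) (Inr t) = 2 / (real p + real n)"
    if "s \<in> R" "t \<in> R" "s \<noteq> t" for s t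
  proof -
    \<comment> \<open>No current enters \<open>G\<close> or the vertices outside \<open>R\<close>,
      so \<open>f\<close> and \<open>S\<close> are 0.\<close>
    define g where "g = (\<lambda>y. (of_bool (y = s) - of_bool (y = t)) / (real p + real n))"
    have R: "sum g R = 0" and U: "sum g UNIV = 0"
      using that by (simp_all add: g_def sum_subtractf flip: sum_divide_distrib)
    have g: "y \<in> R \<Longrightarrow> (real p + real n) * g y = of_bool (y = s) - of_bool (y = t)"
      "y \<notin> R \<Longrightarrow> real p * g y = 0" for y
      using that p pn by (auto simp: g_def)
    have "r (Inr s) (Inr t) =
        case_sum (($) 0) g (Inr s :: 'a + 'p) - case_sum (($) 0) g (Inr t :: 'a + 'p)"
      by (rule pot) (use that in \<open>auto simp: R U g\<close>)
    then show ?thesis using that by (simp add: g_def)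
  qed
  have ii: "r (Inr s) (Inr t) =
      (real k * (2 * real p + real n) + real n) / (real k * real p * (real p + real n))"
    if "s \<in> R" "t \<notin> R" for s t
  proof -
    \<comment> \<open>One unit leaves outside \<open>R\<close>, so \<open>S = - 1 / k\<close> enters
      both branches; \<open>f\<close> is 0.\<close>
    define g where "g = (\<lambda>y. if y \<in> R then (of_bool (y = s) - 1 / real k) / (real p + real n)
      else - (of_bool (y = t) + 1 / real k) / real p)"
    have "sum g R = (\<Sum>y\<in>R. of_bool (y = s) - 1 / real k) / (real p + real n)"
      by (simp add: g_def sum_divide_distrib)
    then have R: "sum g R = 0"
      using sum_R that by simp
    have "sum g (- R) = - (\<Sum>y\<in>- R. of_bool (y = t) + 1 / real k) / real p"
      by (simp add: g_def sum_divide_distrib flip: sum_negf)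
    then have U: "sum g UNIV = - 1 / real k"
      using sum_Compl that p by (simp add: UNIV_sum R)
    have g: "y \<in> R \<Longrightarrow> (real p + real n) * g y = of_bool (y = s) - 1 / real k"
      "y \<notin> R \<Longrightarrow> real p * g y = - (of_bool (y = t) + 1 / real k)" for y
      using that p pn by (auto simp: g_def)
    have "r (Inr s) (Inr t) =
        case_sum (($) 0) g (Inr s :: 'a + 'p) - case_sum (($) 0) g (Inr t :: 'a + 'p)"
      by (rule pot) (use that in \<open>auto simp: R U g\<close>)
    then show ?thesis using that k p pn by (simp add: g_def divide_simps) (simp add: algebra_simps)
  qed
  have iii: "r (Inr s) (Inl j) = (real k - 1) / (real k * (real p + real n)) + M $ j $ j"
    if "s \<in> R" for s j
  proof -
    \<comment> \<open>Here \<open>S = 0\<close>, so \<open>g\<close> vanishes outside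
      \<open>R\<close>; the \<open>- 1 / k\<close> on \<open>R\<close> is the sum of
      \<open>f\<close>, driven by the unit leaving at \<open>j\<close>.\<close>
    define g where "g = (\<lambda>y. if y \<in> R then (of_bool (y = s) - 1 / real k) / (real p + real n)
      else 0)"
    define f where "f = M *v (- axis j 1)"
    have f: "f $ a = - M $ a $ j" for a
      by (simp add: f_def Mneg Mcol)
    have "sum g R = (\<Sum>y\<in>R. of_bool (y = s) - 1 / real k) / (real p + real n)"
      by (simp add: g_def sum_divide_distrib)
    then have R: "sum g R = 0"
      using sum_R that by simp
    then have U: "sum g UNIV = 0"
      by (simp add: UNIV_sum) (simp add: g_def)
    have g: "y \<in> R \<Longrightarrow> (real p + real n) * g y = of_bool (y = s) - 1 / real k"
      "y \<notin> R \<Longrightarrow> real p * g y = 0" for y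
      using that p pn by (auto simp: g_def)
    have "r (Inr s) (Inl j) = case_sum (($) f) g (Inr s) - case_sum (($) f) g (Inl j)"
    proof (rule pot)
      show "(A *v f) $ a = of_bool (Inl a = (Inr s :: 'a + 'p)) - of_bool (Inl a = Inl j)" for a
        by (simp add: f_def AM axis_def)
    qed (use that in \<open>auto simp: R U g f sum_negf Msum\<close>)
    then show ?thesis using that k pn by (simp add: g_def f divide_simps)
  qed
  have iv: "r (Inr s) (Inr t) = 2 / real p" if "s \<notin> R" "t \<notin> R" "s \<noteq> t" for s t
  proof -
    \<comment> \<open>The two currents outside \<open>R\<close> cancel, so \<open>S = 0\<close>, and
      the numerator vanishes on \<open>R\<close>.\<close>
    define g where "g = (\<lambda>y. (of_bool (y = s) - of_bool (y = t)) / real p)"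
    have R: "sum g R = 0" and U: "sum g UNIV = 0"
      using that by (simp_all add: g_def sum_subtractf flip: sum_divide_distrib)
    have g: "y \<in> R \<Longrightarrow> (real p + real n) * g y = 0"
      "y \<notin> R \<Longrightarrow> real p * g y = of_bool (y = s) - of_bool (y = t)" for y
      using that p pn by (auto simp: g_def)
    have "r (Inr s) (Inr t) =
        case_sum (($) 0) g (Inr s :: 'a + 'p) - case_sum (($) 0) g (Inr t :: 'a + 'p)"
      by (rule pot) (use that in \<open>auto simp: R U g\<close>)
    then show ?thesis using that by (simp add: g_def)
  qed
  have v: "r (Inr s) (Inl j) = (real k + 1) / (real k * real p) + M $ j $ j"
    if "s \<notin> R" for s j
  proof -
    \<comment> \<open>On \<open>R\<close>, \<open>S = 1 / k\<close> cancels against the sum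
      \<open>- 1 / k\<close> of \<open>f\<close>.\<close>
    define g where "g = (\<lambda>y. if y \<in> R then 0 else (of_bool (y = s) + 1 / real k) / real p)"
    define f where "f = M *v (- axis j 1)"
    have f: "f $ a = - M $ a $ j" for a
      by (simp add: f_def Mneg Mcol)
    have R: "sum g R = 0" by (simp add: g_def)
    have "sum g (- R) = (\<Sum>y\<in>- R. of_bool (y = s) + 1 / real k) / real p"
      by (simp add: g_def sum_divide_distrib)
    then have U: "sum g UNIV = 1 / real k"
      using sum_Compl that p by (simp add: UNIV_sum R)
    have g: "y \<in> R \<Longrightarrow> (real p + real n) * g y = 0"
      "y \<notin> R \<Longrightarrow> real p * g y = of_bool (y = s) + 1 / real k" for y
      using that p pn by (auto simp: g_def)
    have "r (Inr s) (Inl j) = case_sum (($) f) g (Inr s) - case_sum (($) f) g (Inl j)"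
    proof (rule pot)
      show "(A *v f) $ a = of_bool (Inl a = (Inr s :: 'a + 'p)) - of_bool (Inl a = Inl j)" for a
        by (simp add: f_def AM axis_def)
    qed (use that in \<open>auto simp: R U g f sum_negf Msum\<close>)
    then show ?thesis using that k p by (simp add: g_def f divide_simps)
  qed
  have vi: "r (Inl i) (Inl j) = M $ i $ i + M $ j $ j - 2 * M $ i $ j" for i j
  proof -
    \<comment> \<open>The currents in \<open>G\<close> cancel, so \<open>f\<close> sums to 0 and the
      whole big clique stays at potential 0.\<close>
    define f where "f = M *v (axis i 1 - axis j 1)"
    have f: "f $ a = M $ a $ i - M $ a $ j" for a
      by (simp add: f_def matrix_vector_mult_diff_distrib Mcol)
    have "r (Inl i) (Inl j) =
        case_sum (($) f) (\<lambda>_. 0) (Inl i :: 'a + 'p) - case_sum (($) f) (\<lambda>_. 0) (Inl j :: 'a + 'p)"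
    proof (rule pot)
      show "(A *v f) $ a = of_bool (Inl a = (Inl i :: 'a + 'p)) - of_bool (Inl a = Inl j)" for a
        by (simp add: f_def AM axis_def)
    qed (auto simp: f sum_subtractf Msum)
    then show ?thesis by (simp add: f Msym[of j i])
  qed
  have T: "VK - T = Inr ` (- R)" "T = Inr ` R"
    by (auto simp: T_def VK_def R_def)
  show ?thesis
    unfolding T(1) unfolding T(2) by (auto simp: i ii iii iv v vi)
qed

end
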